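(* Let $N\in\mathbb{N}$, $x_n\in\mathbb{X}$, $\overline{\alpha}\in(0,1]$ and $m_n\in\{2,\ldots,N-1\}$ be such that $$V_N(x_n)\ \ge\ V_N(x_{u_N}(m_n;x_n))+\overline{\alpha}\sum_{k=0}^{m_n-1}\ell\big(x_{u_N}(k;x_n),u_N(k;x_n)\big).$$ Suppose that for some $j\in\{1,\ldots,m_n-1\}$, writing $y:=x_{u_N}(j;x_n)$, $$V_N\big(x_{u_N}(m_n-j;y)\big)-V_{N-j}(y)\ \le\ (1-\overline{\alpha})\sum_{k=0}^{j-1}\ell\big(x_{u_N}(k;x_n),u_N(k;x_n)\big)-\overline{\alpha}\sum_{k=j}^{m_n-1}\ell\big(x_{u_N}(k-j;y),u_N(k-j;y)\big).$$ Then the control sequence $u_N(\cdot;x_n)$ can be replaced by $$\hat u_N(k;x_n):=\begin{cases}u_N(k;x_n),&k\le j-1,\\ u_N(k-j;x_{u_N}(j;x_n)),&k\ge j,\end{cases}$$ and the lower bound $\overline{\alpha}$ on the degree of suboptimality is locally maintained, i.e. $$V_N(x_n)\ \ge\ V_N(x_{\hat u_N}(m_n;x_n))+\overline{\alpha}\sum_{k=0}^{m_n-1}\ell\big(x_{\hat u_N}(k;x_n),\hat u_N(k;x_n)\big).$$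
   Context: Let $X,U$ be Banach spaces with metrics $d_X,d_U$, let $\mathbb{X}\subset X$, $\mathbb{U}\subset U$ (state and control constraints), and let $f:X\times U\to X$ define the system $x(n+1)=f(x(n),u(n))$, $x(0)=x_0$. For a control sequence $u$, $x_u(\cdot;x_0)$ denotes the resulting trajectory with $x_u(0;x_0)=x_0$. Let $x^\star\in\mathbb{X}$ and $u^\star\in\mathbb{U}$ with $f(x^\star,u^\star)=x^\star$. The stage cost $\ell:X\times U\to[0,\infty)$ is continuous, $\ell(x^\star,u^\star)=0$, and $\ell(x,u)>0$ for all $u\in U$ and all $x\ne x^\star$. Viability is assumed: for every $x\in\mathbb{X}$ there is $u_x\in\mathbb{U}$ with $f(x,u_x)\in\mathbb{X}$. For $M\in\mathbb{N}$, $J_M(x_0,u)=\sum_{k=0}^{M-1}\ell(x_u(k;x_0),u(k))$, and $V_M(x_0)$ is the minimum of $J_M(x_0,u)$ over all $u\in\mathbb{U}^M$ with $x_u(k;x_0)\in\mathbb{X}$ for $k=1,\ldots,M$. Minima are assumed to be attained. $u_N(\cdot;x_0)$ denotes a (chosen) minimizer for horizon $N$, and $x_{u_N}(\cdot;x_0)$ the corresponding open loop trajectory. *)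

theory Defs
  imports "HOL-Analysis.Analysis"
begin

primrec traj :: "('x \<Rightarrow> 'u \<Rightarrow> 'x) \<Rightarrow> (nat \<Rightarrow> 'u) \<Rightarrow> 'x \<Rightarrow> nat \<Rightarrow> 'x" where
  "traj f u x0 0 = x0"
| "traj f u x0 (Suc n) = f (traj f u x0 n) (u n)"

text \<open>Control sequences are functions on the naturals; for horizon \<open>M\<close> only the values at
  \<open>k < M\<close> are constrained or used. Hence elements of the \<open>M\<close>-fold product of the control constraint
  set are represented by sequences with arbitrary values from index \<open>M\<close> on.\<close>

definition admissible ::
  "('x \<Rightarrow> 'u \<Rightarrow> 'x) \<Rightarrow> 'x set \<Rightarrow> 'u set \<Rightarrow> nat \<Rightarrow> 'x \<Rightarrow> (nat \<Rightarrow> 'u) \<Rightarrow> bool" where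
  "admissible f XX UU M x0 u \<longleftrightarrow>
     (\<forall>k<M. u k \<in> UU) \<and> (\<forall>k\<in>{1..M}. traj f u x0 k \<in> XX)"

definition cost ::
  "('x \<Rightarrow> 'u \<Rightarrow> 'x) \<Rightarrow> ('x \<Rightarrow> 'u \<Rightarrow> real) \<Rightarrow> nat \<Rightarrow> 'x \<Rightarrow> (nat \<Rightarrow> 'u) \<Rightarrow> real" where
  "cost f ell M x0 u = (\<Sum>k<M. ell (traj f u x0 k) (u k))"

text \<open>The minimum of the cost; meaningful only where the minimum is attained
  (see \<open>minima_attained\<close> below).\<close>

definition val ::
  "('x \<Rightarrow> 'u \<Rightarrow> 'x) \<Rightarrow> ('x \<Rightarrow> 'u \<Rightarrow> real) \<Rightarrow> 'x set \<Rightarrow> 'u set \<Rightarrow> nat \<Rightarrow> 'x \<Rightarrow> real" where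
  "val f ell XX UU M x0 = (LEAST v. \<exists>u. admissible f XX UU M x0 u \<and> v = cost f ell M x0 u)"

definition minimizer ::
  "('x \<Rightarrow> 'u \<Rightarrow> 'x) \<Rightarrow> ('x \<Rightarrow> 'u \<Rightarrow> real) \<Rightarrow> 'x set \<Rightarrow> 'u set \<Rightarrow> nat \<Rightarrow> 'x \<Rightarrow> (nat \<Rightarrow> 'u) \<Rightarrow> bool" where
  "minimizer f ell XX UU M x0 u \<longleftrightarrow>
     admissible f XX UU M x0 u \<and>
     (\<forall>v. admissible f XX UU M x0 v \<longrightarrow> cost f ell M x0 u \<le> cost f ell M x0 v)"

text \<open>The metrics are not assumed to be the ones induced by the norms; continuity of the stage
  cost refers to the topologies they generate. Taking \<open>dX = dist\<close> and \<open>dU = dist\<close> gives the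
  norm topologies.\<close>

locale control_system =
  fixes dX :: "'x::banach \<Rightarrow> 'x \<Rightarrow> real"
    and dU :: "'u::banach \<Rightarrow> 'u \<Rightarrow> real"
    and XX :: "'x set" and UU :: "'u set"
    and f :: "'x \<Rightarrow> 'u \<Rightarrow> 'x"
    and ell :: "'x \<Rightarrow> 'u \<Rightarrow> real"
    and xstar :: 'x and ustar :: 'u
  assumes metric_X: "Metric_space UNIV dX"
    and metric_U: "Metric_space UNIV dU"
    and xstar_in: "xstar \<in> XX"
    and ustar_in: "ustar \<in> UU"
    and equilibrium: "f xstar ustar = xstar"
    and ell_nonneg: "ell x u \<ge> 0"
    and ell_continuous:
      "continuous_map
         (prod_topology (Metric_space.mtopology UNIV dX) (Metric_space.mtopology UNIV dU))
         euclideanreal (\<lambda>(x, u). ell x u)"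
    and ell_equilibrium: "ell xstar ustar = 0"
    and ell_pos: "x \<noteq> xstar \<Longrightarrow> ell x u > 0"
    and viability: "x \<in> XX \<Longrightarrow> \<exists>u\<in>UU. f x u \<in> XX"
    and minima_attained: "x \<in> XX \<Longrightarrow> \<exists>u. minimizer f ell XX UU M x u"

text \<open>Here \<open>uN x\<close> is the chosen minimizer for initial value \<open>x\<close>.\<close>

definition spliced_control ::
  "('x \<Rightarrow> 'u \<Rightarrow> 'x) \<Rightarrow> ('x \<Rightarrow> nat \<Rightarrow> 'u) \<Rightarrow> nat \<Rightarrow> 'x \<Rightarrow> nat \<Rightarrow> 'u" where
  "spliced_control f uN j x k =
     (if k < j then uN x k else uN (traj f (uN x) x j) (k - j))"

end

theory Submission
  imports Defs
begin

text \<open>The argument is one application of the dynamic programming principle. The part of an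
  optimal sequence for horizon \<open>N\<close> that comes after time \<open>j\<close> is admissible for horizon \<open>N - j\<close>
  from the state \<open>y\<close> reached at time \<open>j\<close> (lemma \<open>admissible_add\<close>), so it costs at least the
  optimal value of that shorter problem. With \<open>S\<close> the cost of the first \<open>j\<close> steps this gives
  \<open>V\<^sub>N(x\<^sub>n) \<ge> S + V\<^sub>N\<^sub>-\<^sub>j(y)\<close> (lemma \<open>val_ge_initial_cost_plus_val\<close>).

  Let \<open>T\<close> be the cost of the first \<open>m - j\<close> steps of the sequence optimal from \<open>y\<close>, and \<open>z\<close> the
  state where these steps end. The update condition bounds \<open>V\<^sub>N\<^sub>-\<^sub>j(y)\<close> from below by
  \<open>V\<^sub>N(z) - (1 - \<alpha>) S + \<alpha> T\<close>, hence \<open>V\<^sub>N(x\<^sub>n) \<ge> V\<^sub>N(z) + \<alpha> (S + T)\<close>. The spliced control follows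
  the old optimal trajectory up to \<open>y\<close> and the new one afterwards, so after \<open>m\<close> steps it is at
  \<open>z\<close> and has accumulated exactly the cost \<open>S + T\<close>; this is the claimed inequality. The spliced
  control is admissible because its two pieces are: the sequence optimal from \<open>y\<close> is admissible
  for horizon \<open>N\<close>, hence for the remaining horizon \<open>N - j\<close>.\<close>

lemma traj_cong:
  assumes "\<And>i. i < k \<Longrightarrow> u i = v i"
  shows "traj f u x k = traj f v x k"
  using assms by (induction k) auto

lemma traj_add:
  "traj f u x (j + i) = traj f (\<lambda>k. u (j + k)) (traj f u x j) i"
  by (induction i) auto

lemma cost_cong:
  assumes "\<And>i. i < M \<Longrightarrow> u i = v i"
  shows "cost f ell M x u = cost f ell M x v"
  unfolding cost_def
proof (intro sum.cong refl)
  fix k assume "k \<in> {..<M}"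
  then have "traj f u x k = traj f v x k" and "u k = v k"
    using assms by (auto intro!: traj_cong)
  then show "ell (traj f u x k) (u k) = ell (traj f v x k) (v k)"
    by simp
qed

lemma cost_add:
  "cost f ell (j + M) x u = cost f ell j x u + cost f ell M (traj f u x j) (\<lambda>k. u (j + k))"
proof -
  have "cost f ell (j + M) x u =
      cost f ell j x u + (\<Sum>k<M. ell (traj f u x (j + k)) (u (j + k)))"
    unfolding cost_def by (induction M) (auto simp: algebra_simps)
  then show ?thesis
    by (simp add: cost_def traj_add)
qed

lemma admissible_cong:
  assumes "\<And>i. i < M \<Longrightarrow> u i = v i"
  shows "admissible f XX UU M x u \<longleftrightarrow> admissible f XX UU M x v"
proof -
  have "traj f u x k = traj f v x k" if "k \<in> {1..M}" for k
    using that assms by (intro traj_cong) auto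
  then show ?thesis
    using assms by (auto simp: admissible_def)
qed

lemma admissible_mono:
  assumes "admissible f XX UU N x u" and "M \<le> N"
  shows "admissible f XX UU M x u"
  using assms by (auto simp: admissible_def)

text \<open>Admissibility constrains the controls and the states separately at each time, with no
  coupling between different times; so it can be checked on the two sides of time \<open>j\<close>
  independently. Read from left to right this yields tails of admissible sequences, read from
  right to left it yields concatenations.\<close>

lemma admissible_add:
  "admissible f XX UU (j + M) x u \<longleftrightarrow>
     admissible f XX UU j x u \<and> admissible f XX UU M (traj f u x j) (\<lambda>k. u (j + k))"
proof -
  have "(\<forall>k<j + M. u k \<in> UU) \<longleftrightarrow> (\<forall>k<j. u k \<in> UU) \<and> (\<forall>k<M. u (j + k) \<in> UU)"
  proof -
    have "k < j + M \<longleftrightarrow> k < j \<or> (\<exists>i<M. k = j + i)" for k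
      by presburger
    then show ?thesis
      by blast
  qed
  moreover have "(\<forall>k\<in>{1..j + M}. traj f u x k \<in> XX) \<longleftrightarrow>
      (\<forall>k\<in>{1..j}. traj f u x k \<in> XX) \<and> (\<forall>k\<in>{1..M}. traj f u x (j + k) \<in> XX)"
  proof -
    have "k \<in> {1..j + M} \<longleftrightarrow> k \<in> {1..j} \<or> (\<exists>i\<in>{1..M}. k = j + i)" for k
      unfolding Bex_def atLeastAtMost_iff by presburger
    then show ?thesis
      by blast
  qed
  ultimately show ?thesis
    by (auto simp: admissible_def traj_add)
qed

text \<open>\<open>val\<close> is a \<open>LEAST\<close> over the reals, which is unspecified unless the set of costs has a
  minimum; a minimizer supplies that minimum.\<close>

lemma val_eq_cost_minimizer:
  assumes "minimizer f ell XX UU M x u"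
  shows "val f ell XX UU M x = cost f ell M x u"
  unfolding val_def using assms by (intro Least_equality) (auto simp: minimizer_def)

lemma val_le_cost:
  assumes "minimizer f ell XX UU M x w" and "admissible f XX UU M x u"
  shows "val f ell XX UU M x \<le> cost f ell M x u"
  using assms val_eq_cost_minimizer by (metis minimizer_def)

text \<open>One half of the dynamic programming principle: the tail of an optimal sequence competes in
  the shorter problem, so it costs at least that problem's optimal value.\<close>

lemma val_ge_initial_cost_plus_val:
  assumes opt: "minimizer f ell XX UU N x u"
    and "j \<le> N"
    and tail: "minimizer f ell XX UU (N - j) (traj f u x j) w"
  shows "cost f ell j x u + val f ell XX UU (N - j) (traj f u x j) \<le> val f ell XX UU N x"
proof -
  have N: "N = j + (N - j)"
    using \<open>j \<le> N\<close> by simp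
  have "admissible f XX UU (j + (N - j)) x u"
    using opt by (simp add: minimizer_def flip: N)
  then have "admissible f XX UU (N - j) (traj f u x j) (\<lambda>k. u (j + k))"
    unfolding admissible_add by simp
  then have "val f ell XX UU (N - j) (traj f u x j)
      \<le> cost f ell (N - j) (traj f u x j) (\<lambda>k. u (j + k))"
    by (rule val_le_cost[OF tail])
  then have "cost f ell j x u + val f ell XX UU (N - j) (traj f u x j)
      \<le> cost f ell (j + (N - j)) x u"
    by (simp add: cost_add)
  then show ?thesis
    by (simp add: val_eq_cost_minimizer[OF opt] flip: N)
qed

lemma spliced_control_before:
  "k < j \<Longrightarrow> spliced_control f uN j x k = uN x k"
  by (simp add: spliced_control_def)

lemma spliced_control_after:
  "(\<lambda>k. spliced_control f uN j x (j + k)) = uN (traj f (uN x) x j)"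
  by (simp add: spliced_control_def)

lemma traj_spliced_control_switch:
  "traj f (spliced_control f uN j x) x j = traj f (uN x) x j"
  by (rule traj_cong) (rule spliced_control_before)

lemma traj_spliced_control_after:
  "traj f (spliced_control f uN j x) x (j + i) =
     traj f (uN (traj f (uN x) x j)) (traj f (uN x) x j) i"
  by (simp add: traj_add spliced_control_after traj_spliced_control_switch)

lemma cost_spliced_control:
  "cost f ell (j + M) x (spliced_control f uN j x) =
     cost f ell j x (uN x) + cost f ell M (traj f (uN x) x j) (uN (traj f (uN x) x j))"
  using cost_cong[of j "spliced_control f uN j x" "uN x" f ell x]
  by (simp add: cost_add spliced_control_before spliced_control_after traj_spliced_control_switch)

lemma admissible_spliced_control:
  "admissible f XX UU (j + M) x (spliced_control f uN j x) \<longleftrightarrow>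
     admissible f XX UU j x (uN x) \<and>
     admissible f XX UU M (traj f (uN x) x j) (uN (traj f (uN x) x j))"
  using admissible_cong[of j "spliced_control f uN j x" "uN x" f XX UU x]
  by (simp add: admissible_add spliced_control_before spliced_control_after
      traj_spliced_control_switch)

theorem proposition5p1:
  fixes dX :: "'x::banach \<Rightarrow> 'x \<Rightarrow> real"
    and dU :: "'u::banach \<Rightarrow> 'u \<Rightarrow> real"
    and XX :: "'x set" and UU :: "'u set"
    and f :: "'x \<Rightarrow> 'u \<Rightarrow> 'x"
    and ell :: "'x \<Rightarrow> 'u \<Rightarrow> real"
    and xstar :: 'x and ustar :: 'u
    and N m j :: nat
    and uN :: "'x \<Rightarrow> nat \<Rightarrow> 'u"
    and xn y :: 'x
    and \<alpha> :: real
    and uhat :: "nat \<Rightarrow> 'u"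
  assumes sys: "control_system dX dU XX UU f ell xstar ustar"
    and uN: "\<And>x. x \<in> XX \<Longrightarrow> minimizer f ell XX UU N x (uN x)"
    and xn: "xn \<in> XX"
    and \<alpha>: "0 < \<alpha>" "\<alpha> \<le> 1"
    and m: "m \<in> {2..N - 1}"
    and decrease:
      "val f ell XX UU N xn \<ge> val f ell XX UU N (traj f (uN xn) xn m)
         + \<alpha> * (\<Sum>k<m. ell (traj f (uN xn) xn k) (uN xn k))"
    and j: "j \<in> {1..m - 1}"
    and y: "y = traj f (uN xn) xn j"
    and update:
      "val f ell XX UU N (traj f (uN y) y (m - j)) - val f ell XX UU (N - j) y
         \<le> (1 - \<alpha>) * (\<Sum>k<j. ell (traj f (uN xn) xn k) (uN xn k))
           - \<alpha> * (\<Sum>k\<in>{j..<m}. ell (traj f (uN y) y (k - j)) (uN y (k - j)))"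
    and uhat: "uhat = spliced_control f uN j xn"
  shows "admissible f XX UU N xn uhat \<and>
         val f ell XX UU N xn \<ge> val f ell XX UU N (traj f uhat xn m)
           + \<alpha> * (\<Sum>k<m. ell (traj f uhat xn k) (uhat k))"
proof -
  interpret control_system dX dU XX UU f ell xstar ustar
    by (rule sys)
  have "1 \<le> j" "j < m" "m < N"
    using m j by auto
  then have split: "N = j + (N - j)" "m = j + (m - j)" and "j \<le> N"
    by auto
  have opt: "minimizer f ell XX UU N xn (uN xn)"
    using uN[OF xn] .
  then have adm: "admissible f XX UU N xn (uN xn)"
    by (simp add: minimizer_def)
  then have yX: "y \<in> XX"
    using \<open>1 \<le> j\<close> \<open>j \<le> N\<close> by (auto simp: y admissible_def)

  have "admissible f XX UU j xn (uN xn)"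
    using adm \<open>j \<le> N\<close> by (rule admissible_mono)
  moreover have "admissible f XX UU (N - j) y (uN y)"
    using uN[OF yX] by (auto simp: minimizer_def intro: admissible_mono[of f XX UU N])
  ultimately have "admissible f XX UU (j + (N - j)) xn uhat"
    by (simp add: uhat admissible_spliced_control y)
  then have adm_uhat: "admissible f XX UU N xn uhat"
    by (simp flip: split)

  define S where "S = cost f ell j xn (uN xn)"
  define T where "T = cost f ell (m - j) y (uN y)"
  define z where "z = traj f (uN y) y (m - j)"

  have "(\<Sum>k\<in>{j..<m}. ell (traj f (uN y) y (k - j)) (uN y (k - j))) = T"
    unfolding T_def cost_def
    by (rule sum.reindex_bij_witness[of _ "\<lambda>k. k + j" "\<lambda>k. k - j"]) auto
  then have upd: "val f ell XX UU N z - val f ell XX UU (N - j) y \<le> (1 - \<alpha>) * S - \<alpha> * T"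
    using update by (simp add: S_def cost_def z_def)

  obtain w where "minimizer f ell XX UU (N - j) y w"
    using minima_attained[OF yX] by blast
  then have dp: "S + val f ell XX UU (N - j) y \<le> val f ell XX UU N xn"
    using val_ge_initial_cost_plus_val[OF opt \<open>j \<le> N\<close>] by (simp add: S_def y)

  have "traj f uhat xn (j + (m - j)) = z"
    unfolding uhat traj_spliced_control_after by (simp add: z_def y)
  moreover have "cost f ell (j + (m - j)) xn uhat = S + T"
    unfolding uhat cost_spliced_control by (simp add: S_def T_def y)
  ultimately have "traj f uhat xn m = z"
    and "(\<Sum>k<m. ell (traj f uhat xn k) (uhat k)) = S + T"
    by (simp_all add: cost_def flip: split)
  moreover have "val f ell XX UU N z + \<alpha> * (S + T) \<le> val f ell XX UU N xn"
    using upd dp by (simp add: algebra_simps)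
  ultimately show ?thesis
    using adm_uhat by simp
qed

end
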